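(* Let $I=\langle g_1,\dots,g_s\rangle\subseteq\mathbb{F}_q[x_1,\dots,x_k]$ be an ideal containing $x_1^q-x_1,\dots,x_k^q-x_k$, let $\mathcal{V}(I)=\{P_1,\dots,P_n\}$, let $L\subseteq R=\mathbb{F}_q[x_1,\dots,x_k]/I$ be an $\mathbb{F}_q$-vector subspace of dimension $r$ linearly generated by $b_1,\dots,b_r$, and let $C^\perp(I,L)$ be the associated affine-variety code. Let $1\le w\le n$. Let $J_w$ be the ideal in $\mathbb{F}_q[x_{1,1},\dots,x_{1,k},\dots,x_{w,1},\dots,x_{w,k},z_1,\dots,z_w]$ generated by $$\sum_{i=1}^w z_i\,b_j(x_{i,1},\dots,x_{i,k}),\quad j=1,\dots,r,$$ $$g_h(x_{i,1},\dots,x_{i,k}),\quad i=1,\dots,w,\ h=1,\dots,s,$$ $$z_i^{q-1}-1,\quad i=1,\dots,w,$$ $$\prod_{1\le l\le k}\big((x_{j,l}-x_{i,l})^{q-1}-1\big),\quad 1\le j<i\le w.$$ Then any solution of $J_w$ corresponds to a codeword of $C^\perp(I,L)$ of weight $w$: the solution $(\overline{x}_{1,1},\dots,\overline{x}_{w,k},\overline{z}_1,\dots,\overline{z}_w)\in\mathcal{V}(J_w)$ corresponds to the vector whose coordinate at the point $(\overline{x}_{i,1},\dots,\overline{x}_{i,k})\in\mathcal{V}(I)$ is $\overline{z}_i$ for $i=1,\dots,w$, and whose other coordinates are $0$. Moreover, $$A_w(C^\perp(I,L))=\frac{|\mathcal{V}(J_w)|}{w!}.$$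
   Context: $q$ is a prime power. For an ideal $J$ in a polynomial ring over $\mathbb{F}_q$, $\mathcal{V}(J)$ is the set of its common zeros over the algebraic closure $\overline{\mathbb{F}}_q$. The evaluation map $\phi:R\to(\mathbb{F}_q)^n$, $f\mapsto(f(P_1),\dots,f(P_n))$, is an isomorphism of $\mathbb{F}_q$-vector spaces. The affine-variety code $C(I,L)$ is $\phi(L)$ and $C^\perp(I,L)$ is its dual code, i.e. the set of $c\in(\mathbb{F}_q)^n$ with $\sum_{i=1}^n c_i b_j(P_i)=0$ for $j=1,\dots,r$. For a linear code $C$, $A_w(C)$ is the number of codewords of $C$ of Hamming weight $w$. *)

theory Defs
  imports
    "HOL-Library.Poly_Mapping"
    "HOL-Library.FuncSet"
    "HOL-Library.Cardinality"
    "HOL-Algebra.QuotRing"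
    "HOL-Algebra.Embedded_Algebras"
    "HOL-Algebra.Algebraic_Closure_Type"
    "Jordan_Normal_Form.Matrix"
begin

section \<open>Multivariate polynomials\<close>

text \<open>A monomial maps each variable to its exponent. All index ranges below are zero-based:
  \<open>x\<^sub>1, \<dots>, x\<^sub>k\<close> become the variables in \<open>{..<k}\<close>, and so on.\<close>

type_synonym ('v, 'a) mpol = "('v \<Rightarrow>\<^sub>0 nat) \<Rightarrow>\<^sub>0 'a"

definition mconst :: "'a::comm_ring_1 \<Rightarrow> ('v, 'a) mpol" where
  "mconst a = Poly_Mapping.single 0 a"

definition mvar :: "'v \<Rightarrow> ('v, 'a::comm_ring_1) mpol" where
  "mvar v = Poly_Mapping.single (Poly_Mapping.single v 1) 1"

definition mvars :: "('v, 'a::comm_ring_1) mpol \<Rightarrow> 'v set" where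
  "mvars p = (\<Union>m\<in>Poly_Mapping.keys p. Poly_Mapping.keys m)"

definition mpoly_ring :: "'v set \<Rightarrow> ('v, 'a::comm_ring_1) mpol ring" where
  "mpoly_ring V = ring_of_type_algebra\<lparr>carrier := {p. mvars p \<subseteq> V}\<rparr>"

text \<open>Substitution of \<open>x v\<close> for each variable \<open>v\<close>, with the coefficients mapped along \<open>h\<close>. Taking
  \<open>h = to_ac\<close> gives evaluation over the algebraic closure, and \<open>h = mconst\<close> gives substitution of
  polynomials for the variables.\<close>

definition msubst ::
  "('a::comm_ring_1 \<Rightarrow> 'b::comm_ring_1) \<Rightarrow> ('v \<Rightarrow> 'b) \<Rightarrow> ('v, 'a) mpol \<Rightarrow> 'b" where
  "msubst h x p = (\<Sum>m\<in>Poly_Mapping.keys p. h (Poly_Mapping.lookup p m) *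
      (\<Prod>v\<in>Poly_Mapping.keys m. x v ^ Poly_Mapping.lookup m v))"

text \<open>Common zeros over the algebraic closure of a set of polynomials in the variables \<open>V\<close>. Points
  are extensional functions on \<open>V\<close>, so that distinct functions are distinct points.\<close>

definition zero_set :: "'v set \<Rightarrow> ('v, 'a::field) mpol set \<Rightarrow> ('v \<Rightarrow> 'a alg_closure) set" where
  "zero_set V J = {x \<in> V \<rightarrow>\<^sub>E UNIV. \<forall>f\<in>J. msubst to_ac x f = 0}"


section \<open>Codes\<close>

definition hamming_weight :: "'a::zero vec \<Rightarrow> nat" where
  "hamming_weight c = card {i. i < dim_vec c \<and> c $ i \<noteq> 0}"

definition weight_count :: "'a::zero vec set \<Rightarrow> nat \<Rightarrow> nat" where
  "weight_count C w = card {c \<in> C. hamming_weight c = w}"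

definition dual_code :: "nat \<Rightarrow> 'a::semiring_0 vec set \<Rightarrow> 'a vec set" where
  "dual_code n C = {c \<in> carrier_vec n. \<forall>v\<in>C. c \<bullet> v = 0}"

text \<open>The copy of the field of scalars inside the quotient of the polynomial ring by \<open>I\<close>.\<close>

definition quot_scalars :: "'v set \<Rightarrow> ('v, 'a::field) mpol set \<Rightarrow> ('v, 'a) mpol set set" where
  "quot_scalars V I = range (\<lambda>a. I +>\<^bsub>mpoly_ring V\<^esub> mconst a)"

text \<open>The evaluation map on residue classes at the points \<open>P 0, \<dots>, P (n - 1)\<close> of the variety of the
  ideal. All members of a class take the same value at such a point, so the choice of the
  representative is immaterial. The coordinates of the points formally lie in the algebraic closure;
  because the ideal contains the field equations, they and the values lie in the range of \<open>to_ac\<close>,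
  and \<open>of_ac\<close> returns the corresponding elements of the ground field.\<close>

definition eval_map ::
  "(nat \<Rightarrow> 'v \<Rightarrow> 'a::field alg_closure) \<Rightarrow> nat \<Rightarrow> ('v, 'a) mpol set \<Rightarrow> 'a vec" where
  "eval_map P n A = vec n (\<lambda>i. of_ac (msubst to_ac (P i) (SOME f. f \<in> A)))"

definition affine_variety_code ::
  "(nat \<Rightarrow> 'v \<Rightarrow> 'a::field alg_closure) \<Rightarrow> nat \<Rightarrow> ('v, 'a) mpol set set \<Rightarrow> 'a vec set" where
  "affine_variety_code P n L = eval_map P n ` L"

definition dual_affine_variety_code ::
  "(nat \<Rightarrow> 'v \<Rightarrow> 'a::field alg_closure) \<Rightarrow> nat \<Rightarrow> ('v, 'a) mpol set set \<Rightarrow> 'a vec set" where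
  "dual_affine_variety_code P n L = dual_code n (affine_variety_code P n L)"


section \<open>The ideal of codewords of given weight\<close>

text \<open>\<open>Coord i l\<close> stands for the \<open>l\<close>-th coordinate of the \<open>i\<close>-th point and \<open>Val i\<close> for the value at it.\<close>

datatype wvar = Coord nat nat | Val nat

definition wvars :: "nat \<Rightarrow> nat \<Rightarrow> wvar set" where
  "wvars k w = {Coord i l | i l. i < w \<and> l < k} \<union> {Val i | i. i < w}"

definition at_point :: "nat \<Rightarrow> (nat, 'a::comm_ring_1) mpol \<Rightarrow> (wvar, 'a) mpol" where
  "at_point i f = msubst mconst (\<lambda>l. mvar (Coord i l)) f"

definition weight_ideal ::
  "nat \<Rightarrow> nat \<Rightarrow> nat \<Rightarrow> (nat \<Rightarrow> (nat, 'a) mpol) \<Rightarrow> nat \<Rightarrow> (nat \<Rightarrow> (nat, 'a) mpol)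
    \<Rightarrow> (wvar, 'a::{field, finite}) mpol set" where
  "weight_ideal k w s g r b = Idl\<^bsub>mpoly_ring (wvars k w)\<^esub>
     ({\<Sum>i<w. mvar (Val i) * at_point i (b j) | j. j < r} \<union>
      {at_point i (g h) | i h. i < w \<and> h < s} \<union>
      {mvar (Val i) ^ (CARD('a) - 1) - 1 | i. i < w} \<union>
      {\<Prod>l<k. ((mvar (Coord j l) - mvar (Coord i l)) ^ (CARD('a) - 1) - 1) | i j. j < i \<and> i < w})"

definition solution_point :: "nat \<Rightarrow> (wvar \<Rightarrow> 'b) \<Rightarrow> nat \<Rightarrow> nat \<Rightarrow> 'b" where
  "solution_point k \<sigma> i = (\<lambda>l\<in>{..<k}. \<sigma> (Coord i l))"

text \<open>\<open>c\<close> is the vector with coordinate \<open>\<sigma> (Val i)\<close> at the \<open>i\<close>-th point of \<open>\<sigma>\<close>, for \<open>i < w\<close>, and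
  coordinate 0 at all other points of the variety.\<close>

definition corresponds ::
  "(nat \<Rightarrow> nat \<Rightarrow> 'a::field alg_closure) \<Rightarrow> nat \<Rightarrow> nat \<Rightarrow> nat
    \<Rightarrow> (wvar \<Rightarrow> 'a alg_closure) \<Rightarrow> 'a vec \<Rightarrow> bool" where
  "corresponds P n k w \<sigma> c \<longleftrightarrow> c \<in> carrier_vec n \<and>
     (\<forall>m<n. (\<forall>i<w. P m = solution_point k \<sigma> i \<longrightarrow> to_ac (c $ m) = \<sigma> (Val i)) \<and>
            (P m \<notin> solution_point k \<sigma> ` {..<w} \<longrightarrow> c $ m = 0))"

end

(* Since I contains the field equations, the points of its variety have coordinates in the ground
   field. A zero of the weight ideal is therefore the same as a w-tuple of distinct points of V(I)
   together with nonzero scalars z_i such that the sums of z_i * b_j over the tuple vanish. Because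
   L is spanned by the classes of the b_j, these are the orthogonality relations of the dual code
   for the word with values z_i at the points and 0 elsewhere. So a zero amounts to a codeword of
   weight w with one of the w! orderings of its support. *)

theory Submission
  imports Defs
begin

section \<open>Polynomials and substitution\<close>

text \<open>Zeros are taken over the algebraic closure, whereas codewords live over F_q. The
  polynomials X^q - X and Z^(q-1) - 1 single out F_q and its nonzero elements, but the product
  generators express distinctness only among rational points: for d in F_q the power d^(q-1) is 0 or
  1, so d^(q-1) - 1 vanishes exactly when d is nonzero, and the product vanishes exactly when some
  coordinate differs. For general elements of the closure a nonzero difference need not make its
  factor vanish, so rationality of the points has to be settled before these generators are read.
  The counting forgets polynomials altogether. It needs only an enumerated set of points and
  arbitrary functions \<open>F j\<close> on them, and the factor w! arises as the common fibre size
  of an explicit bijection with a dependent sum, not from a group action.\<close>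

definition mon_val :: "('v \<Rightarrow> 'b::comm_ring_1) \<Rightarrow> ('v \<Rightarrow>\<^sub>0 nat) \<Rightarrow> 'b" where
  "mon_val x m = (\<Prod>v\<in>Poly_Mapping.keys m. x v ^ Poly_Mapping.lookup m v)"

text \<open>Exponents vanish off the keys, so monomials in different variables can be compared over
  one common finite index set.\<close>

lemma mon_val_superset:
  assumes "finite A" "Poly_Mapping.keys m \<subseteq> A"
  shows "mon_val x m = (\<Prod>v\<in>A. x v ^ Poly_Mapping.lookup m v)"
  unfolding mon_val_def
  by (rule prod.mono_neutral_left) (use assms in \<open>auto simp: in_keys_iff\<close>)

lemma mon_val_add: "mon_val x (m + m') = mon_val x m * mon_val x m'"
proof -
  let ?A = "Poly_Mapping.keys m \<union> Poly_Mapping.keys m'"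
  have "mon_val x (m + m') = (\<Prod>v\<in>?A. x v ^ Poly_Mapping.lookup (m + m') v)"
    by (rule mon_val_superset) (auto dest: set_mp[OF keys_add])
  also have "\<dots> = mon_val x m * mon_val x m'"
    by (simp add: mon_val_superset[of ?A] lookup_add power_add prod.distrib)
  finally show ?thesis .
qed

lemma mpol_eq_sum_single:
  "p = (\<Sum>m\<in>Poly_Mapping.keys p. Poly_Mapping.single m (Poly_Mapping.lookup p m))"
  by (rule poly_mapping_eqI)
     (auto simp: lookup_sum lookup_single when_def in_keys_iff)

interpretation to_ac_hom: comm_ring_hom to_ac
  by unfold_locales auto

section \<open>Substitution as a ring homomorphism\<close>

context comm_ring_hom
begin

lemma msubst_eq:
  "msubst hom x p = (\<Sum>m\<in>Poly_Mapping.keys p. hom (Poly_Mapping.lookup p m) * mon_val x m)"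
  by (simp add: msubst_def mon_val_def)

lemma msubst_single: "msubst hom x (Poly_Mapping.single m a) = hom a * mon_val x m"
  by (simp add: msubst_eq)

lemma msubst_0: "msubst hom x 0 = 0"
  by (simp add: msubst_eq)

lemma msubst_1: "msubst hom x 1 = 1"
  using msubst_single[of x 0 1] by (simp add: mon_val_def)

lemma msubst_mvar: "msubst hom x (mvar v) = x v"
  by (simp add: mvar_def msubst_single) (simp add: mon_val_def)

lemma msubst_mconst: "msubst hom x (mconst a) = hom a"
  by (simp add: mconst_def msubst_single) (simp add: mon_val_def)

lemma msubst_add: "msubst hom x (p + q) = msubst hom x p + msubst hom x q"
  unfolding msubst_eq by (rule setsum_keys_plus_distrib) (auto simp: hom_add algebra_simps)

lemma msubst_sum: "msubst hom x (sum f A) = (\<Sum>a\<in>A. msubst hom x (f a))"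
  by (induction A rule: infinite_finite_induct) (simp_all add: msubst_0 msubst_add)

text \<open>Both factors are expanded into single terms. On these, multiplication adds exponents,
  which \<open>mon_val_add\<close> turns into a product of values.\<close>

lemma msubst_mult: "msubst hom x (p * q) = msubst hom x p * msubst hom x q"
proof -
  let ?l = "Poly_Mapping.lookup" and ?K = "Poly_Mapping.keys"
  have "p * q = (\<Sum>m\<in>?K p. Poly_Mapping.single m (?l p m)) *
      (\<Sum>m\<in>?K q. Poly_Mapping.single m (?l q m))"
    by (rule arg_cong2[of _ _ _ _ "(*)", OF mpol_eq_sum_single mpol_eq_sum_single])
  also have "\<dots> = (\<Sum>m\<in>?K p. \<Sum>m'\<in>?K q. Poly_Mapping.single (m + m') (?l p m * ?l q m'))"
    by (simp add: sum_product mult_single)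
  finally have "p * q = \<dots>" .
  then show ?thesis
    by (simp add: msubst_sum msubst_single msubst_eq[of x p] msubst_eq[of x q] sum_product
        hom_mult mon_val_add mult_ac)
qed

lemma comm_ring_hom_msubst: "comm_ring_hom (msubst hom x)"
  by unfold_locales (auto simp: msubst_0 msubst_1 msubst_add msubst_mult)

lemma msubst_cong:
  assumes "\<And>v. v \<in> mvars p \<Longrightarrow> x v = y v"
  shows "msubst hom x p = msubst hom y p"
  unfolding msubst_def
proof (intro sum.cong arg_cong2[of _ _ _ _ "(*)"] prod.cong refl)
  fix m v assume "m \<in> Poly_Mapping.keys p" "v \<in> Poly_Mapping.keys m"
  then have "x v = y v" by (intro assms) (auto simp: mvars_def)
  then show "x v ^ Poly_Mapping.lookup m v = y v ^ Poly_Mapping.lookup m v" by simp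
qed

end

interpretation msubst_ac_hom: comm_ring_hom "msubst to_ac x"
  by (rule to_ac_hom.comm_ring_hom_msubst)

section \<open>Variables occurring in a polynomial\<close>

lemma mvars_0 [simp]: "mvars 0 = {}"
  and mvars_1 [simp]: "mvars 1 = {}"
  and mvars_mconst [simp]: "mvars (mconst a) = {}"
  and mvars_uminus [simp]: "mvars (- p) = mvars p"
  and mvars_mvar: "mvars (mvar v) \<subseteq> {v}"
  by (auto simp: mvars_def mconst_def mvar_def in_keys_iff lookup_single when_def
      split: if_splits)

lemma mvars_add: "mvars p \<subseteq> V \<Longrightarrow> mvars q \<subseteq> V \<Longrightarrow> mvars (p + q) \<subseteq> V"
  unfolding mvars_def using keys_add[of p q] by blast

lemma mvars_diff: "mvars p \<subseteq> V \<Longrightarrow> mvars q \<subseteq> V \<Longrightarrow> mvars (p - q) \<subseteq> V"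
  using mvars_add[of p V "- q"] by simp

lemma mvars_mult:
  assumes "mvars p \<subseteq> V" "mvars q \<subseteq> V" shows "mvars (p * q) \<subseteq> V"
proof
  fix v assume "v \<in> mvars (p * q)"
  then obtain m where m: "m \<in> Poly_Mapping.keys (p * q)" "v \<in> Poly_Mapping.keys m"
    by (auto simp: mvars_def)
  then obtain m1 m2 where "m = m1 + m2" "m1 \<in> Poly_Mapping.keys p" "m2 \<in> Poly_Mapping.keys q"
    using keys_mult[of p q] by auto
  with m(2) have "v \<in> mvars p \<union> mvars q"
    using keys_add[of m1 m2] unfolding mvars_def by blast
  with assms show "v \<in> V" by blast
qed

lemma mvars_sum: "(\<And>a. a \<in> A \<Longrightarrow> mvars (f a) \<subseteq> V) \<Longrightarrow> mvars (sum f A) \<subseteq> V"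
  by (induction A rule: infinite_finite_induct) (simp_all add: mvars_add)

lemma mvars_prod: "(\<And>a. a \<in> A \<Longrightarrow> mvars (f a) \<subseteq> V) \<Longrightarrow> mvars (prod f A) \<subseteq> V"
  by (induction A rule: infinite_finite_induct) (simp_all add: mvars_mult)

lemma mvars_power: "mvars p \<subseteq> V \<Longrightarrow> mvars (p ^ e) \<subseteq> V"
  by (induction e) (simp_all add: mvars_mult)

lemma mvars_msubst:
  assumes "\<And>v. v \<in> mvars p \<Longrightarrow> mvars (y v) \<subseteq> V"
  shows "mvars (msubst mconst y p) \<subseteq> V"
  unfolding msubst_def
  by (intro mvars_sum mvars_mult mvars_prod mvars_power assms)
     (simp, auto simp: mvars_def)

lemma mvars_at_point:
  assumes "mvars p \<subseteq> {..<k}" "i < w"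
  shows "mvars (at_point i p) \<subseteq> wvars k w"
  unfolding at_point_def
  by (rule mvars_msubst, rule order_trans[OF mvars_mvar]) (use assms in \<open>auto simp: wvars_def\<close>)

text \<open>Evaluation is a ring homomorphism, so it passes through the outer substitution until it
  meets only variables \<open>Coord i l\<close> and constants.\<close>

lemma msubst_at_point:
  "msubst to_ac \<sigma> (at_point i f) = msubst to_ac (\<lambda>l. \<sigma> (Coord i l)) f"
  unfolding at_point_def msubst_def[of mconst]
  by (simp only: msubst_ac_hom.hom_sum msubst_ac_hom.hom_mult msubst_ac_hom.hom_prod
      msubst_ac_hom.hom_power to_ac_hom.msubst_mvar to_ac_hom.msubst_mconst)
     (simp only: msubst_def)

lemma msubst_at_point_solution:
  assumes "mvars f \<subseteq> {..<k}"
  shows "msubst to_ac \<sigma> (at_point i f) = msubst to_ac (solution_point k \<sigma> i) f"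
  unfolding msubst_at_point
  by (rule to_ac_hom.msubst_cong) (use assms in \<open>auto simp: solution_point_def\<close>)

section \<open>Ideals and their zeros\<close>

lemma ring_of_type_algebra_simps [simp]:
  "carrier ring_of_type_algebra = UNIV"
  "x \<otimes>\<^bsub>ring_of_type_algebra\<^esub> y = x * y"
  "x \<oplus>\<^bsub>ring_of_type_algebra\<^esub> y = x + y"
  "\<one>\<^bsub>ring_of_type_algebra\<^esub> = 1"
  "\<zero>\<^bsub>ring_of_type_algebra\<^esub> = 0"
  by (simp_all add: ring_of_type_algebra_def)

lemma a_inv_ring_of_type_algebra [simp]:
  "\<ominus>\<^bsub>ring_of_type_algebra\<^esub> (x :: 'a::comm_ring_1) = - x"
proof -
  interpret ring "ring_of_type_algebra :: 'a ring" by (rule ring_from_type_algebra)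
  show ?thesis by (rule minus_equality) auto
qed

lemma mpoly_ring_simps [simp]:
  "carrier (mpoly_ring V) = {p. mvars p \<subseteq> V}"
  "x \<otimes>\<^bsub>mpoly_ring V\<^esub> y = x * y"
  "x \<oplus>\<^bsub>mpoly_ring V\<^esub> y = x + y"
  "\<one>\<^bsub>mpoly_ring V\<^esub> = 1"
  "\<zero>\<^bsub>mpoly_ring V\<^esub> = 0"
  by (simp_all add: mpoly_ring_def)

lemma ring_mpoly_ring: "ring (mpoly_ring V :: ('v, 'a::comm_ring_1) mpol ring)"
proof -
  interpret ring "ring_of_type_algebra :: ('v, 'a) mpol ring" by (rule ring_from_type_algebra)
  show ?thesis
    unfolding mpoly_ring_def
    by (intro subring_is_ring subringI) (simp_all add: mvars_add mvars_mult)
qed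

lemma vanishing_ideal:
  fixes x :: "'v \<Rightarrow> 'a::field alg_closure"
  shows "ideal {f. mvars f \<subseteq> V \<and> msubst to_ac x f = 0} (mpoly_ring V)"
proof -
  interpret ring_hom_ring "mpoly_ring V" "ring_of_type_algebra :: 'a alg_closure ring" "msubst to_ac x"
    by (rule ring_hom_ringI[OF ring_mpoly_ring ring_from_type_algebra])
       (simp_all add: msubst_ac_hom.hom_mult msubst_ac_hom.hom_add)
  show ?thesis
    using kernel_is_ideal
    by (simp only: a_kernel_def' mpoly_ring_simps ring_of_type_algebra_simps mem_Collect_eq)
qed

text \<open>The polynomials vanishing at \<open>x\<close> form an ideal, the kernel of evaluation;
  by minimality it contains the ideal generated by \<open>S\<close>.\<close>

lemma genideal_vanish:
  fixes S :: "('v, 'a::field) mpol set"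
  assumes "\<And>f. f \<in> S \<Longrightarrow> mvars f \<subseteq> V" "\<And>f. f \<in> S \<Longrightarrow> msubst to_ac x f = 0"
    and "f \<in> Idl\<^bsub>mpoly_ring V\<^esub> S"
  shows "msubst to_ac x f = 0"
proof -
  have "Idl\<^bsub>mpoly_ring V\<^esub> S \<subseteq> {f. mvars f \<subseteq> V \<and> msubst to_ac x f = 0}"
    by (rule ring.genideal_minimal[OF ring_mpoly_ring vanishing_ideal]) (use assms in auto)
  with assms show ?thesis by auto
qed

lemma zero_set_genideal:
  assumes "\<And>f. f \<in> S \<Longrightarrow> mvars f \<subseteq> V"
  shows "zero_set V (Idl\<^bsub>mpoly_ring V\<^esub> S) = zero_set V S"
proof -
  have "S \<subseteq> Idl\<^bsub>mpoly_ring V\<^esub> S"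
    by (rule ring.genideal_self[OF ring_mpoly_ring]) (use assms in auto)
  then show ?thesis
    using genideal_vanish[of S V, OF assms] by (auto simp: zero_set_def)
qed

section \<open>The ground field inside its algebraic closure\<close>

text \<open>Multiplication by \<open>x\<close> permutes the nonzero elements. Their product is
  therefore unchanged when each factor is multiplied by \<open>x\<close>, and being nonzero it can
  be cancelled.\<close>

lemma power_card_minus_1:
  fixes x :: "'a::{field, finite}"
  assumes "x \<noteq> 0"
  shows "x ^ (CARD('a) - 1) = 1"
proof -
  have "(\<Prod>y\<in>UNIV-{0}. x * y) = (\<Prod>y\<in>UNIV-{0}. y)"
    by (rule prod.reindex_bij_witness[of _ "\<lambda>y. y / x" "\<lambda>y. x * y"]) (use assms in auto)
  then have "x ^ (CARD('a) - 1) * (\<Prod>y\<in>UNIV-{0::'a}. y) = 1 * (\<Prod>y\<in>UNIV-{0}. y)"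
    by (simp add: prod.distrib card_Diff_singleton)
  then show ?thesis
    by (subst (asm) mult_cancel_right) auto
qed

lemma card_field_gt_1: "CARD('a::{field, finite}) > 1"
  using card_mono[of "UNIV :: 'a set" "{0, 1}"] by simp

text \<open>The \<open>q\<close> elements of the ground field are roots of \<open>X\<^sup>q - X\<close>, which has no room for others.\<close>

lemma range_to_ac_iff:
  fixes x :: "'a::{field, finite} alg_closure"
  shows "x \<in> range to_ac \<longleftrightarrow> x ^ CARD('a) = x"
proof -
  define p :: "'a alg_closure poly" where "p = Polynomial.monom 1 CARD('a) - Polynomial.monom 1 1"
  let ?R = "{x. poly p x = 0}"
  have roots: "?R = {x. x ^ CARD('a) = x}"
    by (auto simp: p_def poly_monom)
  \<comment> \<open>As q > 1, the term X cannot cancel the leading term X^q.\<close>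
  have "Polynomial.coeff p CARD('a) = 1"
    using card_field_gt_1[where ?'a = 'a] by (simp add: p_def)
  then have "p \<noteq> 0" by auto
  have deg: "Polynomial.degree p \<le> CARD('a)"
    unfolding p_def by (rule degree_diff_le) (auto intro!: order_trans[OF degree_monom_le])
  have pow: "a ^ CARD('a) = a" for a :: 'a
  proof (cases "a = 0")
    case False
    then show ?thesis
      using power_card_minus_1[of a] power_minus_mult[of "CARD('a)" a] by simp
  qed simp
  have sub: "range to_ac \<subseteq> ?R"
    by (auto simp: roots pow simp flip: to_ac_power)
  have "card ?R \<le> card (range to_ac :: 'a alg_closure set)"
    using card_poly_roots_bound[OF \<open>p \<noteq> 0\<close>] deg by (simp add: card_image inj_to_ac)
  with sub have "range to_ac = ?R"
    by (intro card_seteq poly_roots_finite \<open>p \<noteq> 0\<close>)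
  then show ?thesis by (simp only: roots) simp
qed

text \<open>For nonzero \<open>x\<close> this is x^q = x with one factor cancelled. At 0 the
  exponent q - 1 is positive, so the power is 0 and not 1.\<close>

lemma range_to_ac_nonzero_iff:
  fixes x :: "'a::{field, finite} alg_closure"
  shows "x ^ (CARD('a) - 1) = 1 \<longleftrightarrow> x \<in> range to_ac \<and> x \<noteq> 0"
proof -
  have step: "x ^ CARD('a) = x ^ (CARD('a) - 1) * x"
    using power_minus_mult[of "CARD('a)" x] by simp
  show ?thesis
  proof (cases "x = 0")
    case True
    have "x ^ (CARD('a) - 1) = 0"
      unfolding True by (rule zero_power) (use card_field_gt_1[where ?'a = 'a] in simp)
    with True show ?thesis by (simp only: zero_neq_one simp_thms)
  next
    case False
    then show ?thesis by (simp add: range_to_ac_iff step del: One_nat_def)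
  qed
qed

text \<open>The evaluation can be carried out in the ground field on the preimages of the
  coordinates; \<open>to_ac\<close> then maps the result to the value in question.\<close>

lemma range_to_ac_msubst:
  assumes "\<And>v. v \<in> mvars f \<Longrightarrow> x v \<in> range to_ac"
  shows "msubst to_ac x f \<in> range to_ac"
proof -
  have "msubst to_ac x f = msubst to_ac (\<lambda>v. to_ac (of_ac (x v))) f"
    by (rule to_ac_hom.msubst_cong) (use assms in \<open>auto simp: to_ac_of_ac\<close>)
  also have "\<dots> = to_ac (msubst id (of_ac \<circ> x) f)"
    by (simp add: msubst_def to_ac_sum to_ac_prod)
  finally show ?thesis by simp
qed

section \<open>The dual of an affine-variety code\<close>

lemma zero_set_mem_ideal:
  "x \<in> zero_set V I \<Longrightarrow> f \<in> I \<Longrightarrow> msubst to_ac x f = 0"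
  by (simp add: zero_set_def)

text \<open>\<open>Span\<close> is built recursively, one line extension per generator; this gives
  it the explicit form of all linear combinations. An arbitrary distinct list replaces
  \<open>[0..<r]\<close> to make the induction go through.\<close>

lemma Span_quot:
  fixes I :: "('v, 'a::field) mpol set" and b :: "'i \<Rightarrow> ('v, 'a) mpol"
  assumes I: "ideal I (mpoly_ring V)" and "\<And>j. j \<in> set js \<Longrightarrow> mvars (b j) \<subseteq> V" "distinct js"
  shows "ring.Span (mpoly_ring V Quot I) (quot_scalars V I)
           (map (\<lambda>j. I +>\<^bsub>mpoly_ring V\<^esub> b j) js) =
         range (\<lambda>a. I +>\<^bsub>mpoly_ring V\<^esub> (\<Sum>j\<in>set js. mconst (a j) * b j))"
  using assms(2,3)
proof (induction js)
  case Nil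
  interpret ideal I "mpoly_ring V" by (rule I)
  have "I +>\<^bsub>mpoly_ring V\<^esub> 0 = \<zero>\<^bsub>mpoly_ring V Quot I\<^esub>"
    using a_coset_add_zero[OF a_subset] by (simp add: FactRing_def)
  then show ?case
    by (simp add: ring.Span.simps[OF ideal.quotient_is_ring[OF I]])
next
  case (Cons j js)
  let ?R = "mpoly_ring V" and ?Q = "mpoly_ring V Quot I"
  let ?c = "\<lambda>p. I +>\<^bsub>?R\<^esub> p" and ?g = "\<lambda>A a. \<Sum>i\<in>A. mconst (a i) * b i"
  interpret Q: ring ?Q by (rule ideal.quotient_is_ring[OF I])
  have comb: "?c p \<otimes>\<^bsub>?Q\<^esub> ?c q \<oplus>\<^bsub>?Q\<^esub> ?c t = ?c (p * q + t)"
    if "mvars p \<subseteq> V" "mvars q \<subseteq> V" "mvars t \<subseteq> V" for p q t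
  proof -
    have "?c (p * q) = ?c p \<otimes>\<^bsub>?Q\<^esub> ?c q"
      using ring_hom_mult[OF ideal.rcos_ring_hom[OF I], of p q] that
      by (simp only: mpoly_ring_simps mem_Collect_eq)
    moreover have "?c (p * q + t) = ?c (p * q) \<oplus>\<^bsub>?Q\<^esub> ?c t"
      using ring_hom_add[OF ideal.rcos_ring_hom[OF I], of "p * q" t] that mvars_mult[OF that(1,2)]
      by (simp only: mpoly_ring_simps mem_Collect_eq)
    ultimately show ?thesis by simp
  qed
  have vars: "mvars (b j) \<subseteq> V" "mvars (?g (set js) a) \<subseteq> V" for a
    by (simp_all only: Cons.prems(1) mvars_sum mvars_mult mvars_mconst empty_subsetI list.set_intros)
  have upd: "?g (set (j # js)) a = mconst (a j) * b j + ?g (set js) a" for a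
    using Cons.prems(2) by simp
  have "Q.Span (quot_scalars V I) (map (\<lambda>j. ?c (b j)) (j # js)) =
      Q.line_extension (quot_scalars V I) (?c (b j)) (range (\<lambda>a. ?c (?g (set js) a)))"
    using Cons by simp
  also have "\<dots> = {?c (mconst x * b j + ?g (set js) a) | x a. True}"
    unfolding set_eq_iff Q.line_extension_mem_iff quot_scalars_def mem_Collect_eq
    using comb[OF _ vars] by (fastforce simp: image_iff)
  also have "\<dots> = range (\<lambda>a. ?c (?g (set (j # js)) a))"
  proof (intro equalityI subsetI)
    fix u assume "u \<in> {?c (mconst x * b j + ?g (set js) a) | x a. True}"
    then obtain x a where u: "u = ?c (mconst x * b j + ?g (set js) a)" by blast
    \<comment> \<open>Distinctness keeps \<open>j\<close> out of \<open>js\<close>, so a single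
      coefficient function can carry both the new scalar \<open>x\<close> and the old coefficients
      \<open>a\<close>.\<close>
    have "?g (set js) (a(j := x)) = ?g (set js) a"
      by (rule sum.cong) (use Cons.prems(2) in auto)
    then have "u = ?c (?g (set (j # js)) (a(j := x)))"
      unfolding u upd by simp
    then show "u \<in> range (\<lambda>a. ?c (?g (set (j # js)) a))" by blast
  next
    fix u assume "u \<in> range (\<lambda>a. ?c (?g (set (j # js)) a))"
    then obtain a where "u = ?c (?g (set (j # js)) a)" by blast
    then show "u \<in> {?c (mconst x * b j + ?g (set js) a) | x a. True}"
      unfolding upd by blast
  qed
  finally show ?case .
qed

text \<open>Whatever representative is chosen, it differs from \<open>f\<close> by an element of
  \<open>I\<close>, which vanishes at every \<open>P m\<close>.\<close>

lemma eval_map_coset: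
  assumes I: "ideal I (mpoly_ring V)" and f: "mvars f \<subseteq> V"
    and P: "\<And>m. m < n \<Longrightarrow> P m \<in> zero_set V I"
  shows "eval_map P n (I +>\<^bsub>mpoly_ring V\<^esub> f) = vec n (\<lambda>m. of_ac (msubst to_ac (P m) f))"
proof -
  let ?A = "I +>\<^bsub>mpoly_ring V\<^esub> f"
  interpret ideal I "mpoly_ring V" by (rule I)
  have "f \<in> ?A"
    by (rule a_rcos_self) (use f in simp)
  then have "(SOME g. g \<in> ?A) \<in> ?A" by (rule someI)
  then obtain i where "i \<in> I" "(SOME g. g \<in> ?A) = i + f"
    unfolding a_r_coset_def' by auto
  then show ?thesis
    using zero_set_mem_ideal[OF P \<open>i \<in> I\<close>]
    by (auto simp: eval_map_def msubst_ac_hom.hom_add intro!: vec_eq_iff[THEN iffD2])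
qed

text \<open>The sum \<open>S f\<close> is linear in \<open>f\<close>, so orthogonality to all of
  \<open>L\<close> reduces to its generators. Rationality of the points makes \<open>S f\<close> the
  image under the injective \<open>to_ac\<close> of the scalar product, so the conditions may be
  stated over the closure.\<close>

lemma dual_affine_variety_code_iff:
  fixes I :: "('v, 'a::field) mpol set"
  assumes I: "ideal I (mpoly_ring V)" and b: "\<And>j. j < r \<Longrightarrow> mvars (b j) \<subseteq> V"
    and P: "\<And>m. m < n \<Longrightarrow> P m \<in> zero_set V I"
    and rational: "\<And>m v. m < n \<Longrightarrow> v \<in> V \<Longrightarrow> P m v \<in> range to_ac"
    and L: "L = ring.Span (mpoly_ring V Quot I) (quot_scalars V I)
                  (map (\<lambda>j. I +>\<^bsub>mpoly_ring V\<^esub> b j) [0..<r])"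
  shows "c \<in> dual_affine_variety_code P n L \<longleftrightarrow>
    c \<in> carrier_vec n \<and> (\<forall>j<r. (\<Sum>m<n. to_ac (c $ m) * msubst to_ac (P m) (b j)) = 0)"
proof -
  define S where "S f = (\<Sum>m<n. to_ac (c $ m) * msubst to_ac (P m) f)" for f
  define comb where "comb a = (\<Sum>j<r. mconst (a j) * b j)" for a
  have comb_vars: "mvars (comb a) \<subseteq> V" for a
    unfolding comb_def by (intro mvars_sum mvars_mult) (simp_all add: b)
  have L_eq: "L = range (\<lambda>a. I +>\<^bsub>mpoly_ring V\<^esub> comb a)"
    unfolding L comb_def by (subst Span_quot[OF I]) (simp_all add: b atLeast0LessThan)
  have S_comb: "S (comb a) = (\<Sum>j<r. to_ac (a j) * S (b j))" for a
  proof -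
    have "S (comb a) = (\<Sum>m<n. \<Sum>j<r. to_ac (a j) * (to_ac (c $ m) * msubst to_ac (P m) (b j)))"
      by (simp add: S_def comb_def msubst_ac_hom.hom_sum msubst_ac_hom.hom_mult
          to_ac_hom.msubst_mconst sum_distrib_left mult_ac)
    also have "\<dots> = (\<Sum>j<r. to_ac (a j) * S (b j))"
      by (subst sum.swap) (simp add: S_def sum_distrib_left)
    finally show ?thesis .
  qed
  have scalar: "c \<bullet> eval_map P n (I +>\<^bsub>mpoly_ring V\<^esub> f) = 0 \<longleftrightarrow> S f = 0"
    if f: "mvars f \<subseteq> V" for f
  proof -
    have "to_ac (of_ac (msubst to_ac (P m) f)) = msubst to_ac (P m) f" if "m < n" for m
      by (intro to_ac_of_ac range_to_ac_msubst rational that) (use f in blast)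
    then have "to_ac (c \<bullet> eval_map P n (I +>\<^bsub>mpoly_ring V\<^esub> f)) = S f"
      by (simp add: eval_map_coset[OF I f P] scalar_prod_def to_ac_sum S_def atLeast0LessThan)
    then show ?thesis by (metis to_ac_eq_0_iff)
  qed
  have "(\<forall>v\<in>affine_variety_code P n L. c \<bullet> v = 0) \<longleftrightarrow> (\<forall>a. S (comb a) = 0)"
    unfolding affine_variety_code_def L_eq using scalar[OF comb_vars] by auto
  also have "\<dots> \<longleftrightarrow> (\<forall>j<r. S (b j) = 0)"
  proof (intro iffI allI impI)
    fix j assume *: "\<forall>a. S (comb a) = 0" and j: "j < r"
    \<comment> \<open>The coefficients of the \<open>j\<close>-th unit vector isolate the generator
      \<open>b j\<close>.\<close>
    have "S (b j) = (\<Sum>i<r. to_ac (if i = j then 1 else 0) * S (b i))"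
      using j by (simp add: if_distrib[of to_ac] if_distrib[of "\<lambda>x. x * _"] cong: if_cong)
    then show "S (b j) = 0"
      unfolding S_comb[symmetric] using * by simp
  qed (simp add: S_comb)
  finally show ?thesis
    unfolding dual_affine_variety_code_def dual_code_def S_def by simp
qed

section \<open>Zeros of the weight ideal\<close>

lemma diff_power_card_eq_1_iff:
  fixes x y :: "'a::{field, finite} alg_closure"
  assumes "x \<in> range to_ac" "y \<in> range to_ac"
  shows "(x - y) ^ (CARD('a) - 1) = 1 \<longleftrightarrow> x \<noteq> y"
proof -
  have "x - y \<in> range to_ac"
    using assms by (auto simp flip: to_ac_diff)
  then show ?thesis
    unfolding range_to_ac_nonzero_iff by auto
qed

text \<open>The zeros of the weight ideal freed of polynomials: \<open>F j\<close> stands for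
  evaluation of the \<open>j\<close>-th generator of the code, and keeping it arbitrary separates
  the counting from the algebra.\<close>

definition weighted_tuples ::
  "(nat \<Rightarrow> 'a::field alg_closure) set \<Rightarrow> nat \<Rightarrow> nat \<Rightarrow> nat
    \<Rightarrow> (nat \<Rightarrow> (nat \<Rightarrow> 'a alg_closure) \<Rightarrow> 'a alg_closure) \<Rightarrow> (wvar \<Rightarrow> 'a alg_closure) set" where
  "weighted_tuples A k w r F = {\<sigma> \<in> wvars k w \<rightarrow>\<^sub>E UNIV.
     (\<forall>i<w. solution_point k \<sigma> i \<in> A) \<and> inj_on (solution_point k \<sigma>) {..<w} \<and>
     (\<forall>i<w. \<sigma> (Val i) \<in> range to_ac \<and> \<sigma> (Val i) \<noteq> 0) \<and>
     (\<forall>j<r. (\<Sum>i<w. \<sigma> (Val i) * F j (solution_point k \<sigma> i)) = 0)}"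

lemma mvars_Coord: "i < w \<Longrightarrow> l < k \<Longrightarrow> mvars (mvar (Coord i l)) \<subseteq> wvars k w"
  and mvars_Val: "i < w \<Longrightarrow> mvars (mvar (Val i)) \<subseteq> wvars k w"
  by (rule order_trans[OF mvars_mvar], simp add: wvars_def)+

text \<open>Passing from the ideal to its generators, each of the four families yields one clause of
  \<open>weighted_tuples\<close>. The points are constrained through the \<open>g h\<close>, since
  these are what the generators contain.\<close>

lemma zero_set_weight_ideal:
  fixes g b :: "nat \<Rightarrow> (nat, 'a::{field, finite}) mpol"
  assumes g: "\<And>h. h < s \<Longrightarrow> mvars (g h) \<subseteq> {..<k}" and b: "\<And>j. j < r \<Longrightarrow> mvars (b j) \<subseteq> {..<k}"
    and rational: "\<And>x l. x \<in> zero_set {..<k} (g ` {..<s}) \<Longrightarrow> l < k \<Longrightarrow> x l \<in> range to_ac"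
  shows "zero_set (wvars k w) (weight_ideal k w s g r b) =
    weighted_tuples (zero_set {..<k} (g ` {..<s})) k w r (\<lambda>j x. msubst to_ac x (b j))"
    (is "?Z = weighted_tuples ?X _ _ _ _")
proof -
  define S1 where "S1 = {\<Sum>i<w. mvar (Val i) * at_point i (b j) | j. j < r}"
  define S2 where "S2 = {at_point i (g h) | i h. i < w \<and> h < s}"
  define S3 where "S3 = {mvar (Val i) ^ (CARD('a) - 1) - (1 :: (wvar, 'a) mpol) | i. i < w}"
  define S4 :: "(wvar, 'a) mpol set" where
    "S4 = {\<Prod>l<k. ((mvar (Coord j l) - mvar (Coord i l)) ^ (CARD('a) - 1) - 1) | i j. j < i \<and> i < w}"
  have vars: "mvars f \<subseteq> wvars k w" if "f \<in> S1 \<union> S2 \<union> S3 \<union> S4" for f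
    using that
  proof (elim UnE)
    assume "f \<in> S1"
    then obtain j where "j < r" "f = (\<Sum>i<w. mvar (Val i) * at_point i (b j))"
      by (auto simp: S1_def)
    then show ?thesis
      by (simp only:) (intro mvars_sum mvars_mult mvars_Val mvars_at_point b; simp)
  next
    assume "f \<in> S2"
    then obtain i h where "i < w" "h < s" "f = at_point i (g h)"
      by (auto simp: S2_def)
    then show ?thesis by (simp add: mvars_at_point g)
  next
    assume "f \<in> S3"
    then obtain i where "i < w" "f = mvar (Val i) ^ (CARD('a) - 1) - 1"
      by (auto simp: S3_def)
    then show ?thesis by (simp add: mvars_diff mvars_power mvars_Val)
  next
    assume "f \<in> S4"
    then obtain i j where "j < i" "i < w"
      "f = (\<Prod>l<k. ((mvar (Coord j l) - mvar (Coord i l)) ^ (CARD('a) - 1) - 1))"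
      by (auto simp: S4_def)
    then show ?thesis
      by (simp only:) (intro mvars_prod mvars_diff mvars_power mvars_Coord; simp)
  qed
  have "?Z = zero_set (wvars k w) (S1 \<union> S2 \<union> S3 \<union> S4)"
    unfolding weight_ideal_def S1_def[symmetric] S2_def[symmetric] S3_def[symmetric] S4_def[symmetric]
    by (rule zero_set_genideal[OF vars])
  also have "\<dots> = weighted_tuples ?X k w r (\<lambda>j x. msubst to_ac x (b j))"
  proof (rule Set.set_eqI)
    fix \<sigma> :: "wvar \<Rightarrow> 'a alg_closure"
    let ?e = "msubst to_ac \<sigma>" and ?p = "solution_point k \<sigma>"
    have 1: "(\<forall>f\<in>S1. ?e f = 0) \<longleftrightarrow>
        (\<forall>j<r. (\<Sum>i<w. \<sigma> (Val i) * msubst to_ac (?p i) (b j)) = 0)"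
      by (auto simp: S1_def msubst_ac_hom.hom_sum msubst_ac_hom.hom_mult
          to_ac_hom.msubst_mvar msubst_at_point_solution[OF b])
    have 2: "(\<forall>f\<in>S2. ?e f = 0) \<longleftrightarrow> (\<forall>i<w. ?p i \<in> ?X)"
    proof -
      have "(\<forall>f\<in>S2. ?e f = 0) \<longleftrightarrow> (\<forall>i<w. \<forall>h<s. ?e (at_point i (g h)) = 0)"
        by (auto simp: S2_def)
      then show ?thesis
        by (auto simp: zero_set_def solution_point_def[of k] msubst_at_point_solution[OF g])
    qed
    have 3: "(\<forall>f\<in>S3. ?e f = 0) \<longleftrightarrow> (\<forall>i<w. \<sigma> (Val i) \<in> range to_ac \<and> \<sigma> (Val i) \<noteq> 0)"
    proof -
      have "(\<forall>f\<in>S3. ?e f = 0) \<longleftrightarrow> (\<forall>i<w. ?e (mvar (Val i) ^ (CARD('a) - 1) - 1) = 0)"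
        by (auto simp: S3_def)
      then show ?thesis
        by (simp only: msubst_ac_hom.hom_minus msubst_ac_hom.hom_power msubst_ac_hom.hom_one
            to_ac_hom.msubst_mvar right_minus_eq range_to_ac_nonzero_iff)
    qed
    \<comment> \<open>Over the ground field, a factor of the product vanishes iff the two coordinates differ.\<close>
    have 4: "(\<forall>f\<in>S4. ?e f = 0) \<longleftrightarrow> inj_on ?p {..<w}" if X: "\<forall>i<w. ?p i \<in> ?X"
    proof -
      have "(\<forall>f\<in>S4. ?e f = 0) \<longleftrightarrow> (\<forall>i<w. \<forall>j<i.
          ?e (\<Prod>l<k. ((mvar (Coord j l) - mvar (Coord i l)) ^ (CARD('a) - 1) - 1)) = 0)"
        by (auto simp: S4_def)
      also have "\<dots> \<longleftrightarrow> (\<forall>i<w. \<forall>j<i. ?p j \<noteq> ?p i)"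
      proof (intro all_cong)
        fix i j assume ij: "i < w" "j < i"
        \<comment> \<open>The clause for the family \<open>S2\<close> already places the points in
          \<open>?X\<close>, and this makes their coordinates rational, as the factors
          require.\<close>
        have range: "\<sigma> (Coord i' l) \<in> range to_ac" if "i' < w" "l < k" for i' l
          using rational[of "?p i'" l] X that by (simp add: solution_point_def)
        have "?e (\<Prod>l<k. ((mvar (Coord j l) - mvar (Coord i l)) ^ (CARD('a) - 1) - 1)) = 0 \<longleftrightarrow>
            (\<exists>l<k. (\<sigma> (Coord j l) - \<sigma> (Coord i l)) ^ (CARD('a) - 1) = 1)"
          by (simp only: msubst_ac_hom.hom_prod msubst_ac_hom.hom_minus msubst_ac_hom.hom_power
              msubst_ac_hom.hom_one to_ac_hom.msubst_mvar prod_zero_iff[OF finite_lessThan]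
              right_minus_eq) auto
        also have "\<dots> \<longleftrightarrow> (\<exists>l<k. \<sigma> (Coord j l) \<noteq> \<sigma> (Coord i l))"
          using ij by (intro ex_cong conj_cong diff_power_card_eq_1_iff range refl) auto
        also have "\<dots> \<longleftrightarrow> ?p j \<noteq> ?p i"
          by (auto simp: solution_point_def fun_eq_iff restrict_def)
        finally show "?e (\<Prod>l<k. ((mvar (Coord j l) - mvar (Coord i l)) ^ (CARD('a) - 1) - 1)) = 0
            \<longleftrightarrow> ?p j \<noteq> ?p i" .
      qed
      \<comment> \<open>Comparing only \<open>j < i\<close> suffices, because inequality is
        symmetric and indices are linearly ordered.\<close>
      also have "\<dots> \<longleftrightarrow> inj_on ?p {..<w}"
        unfolding inj_on_def
        by (metis lessThan_iff linorder_neqE_nat order.strict_trans less_irrefl)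
      finally show ?thesis .
    qed
    show "\<sigma> \<in> zero_set (wvars k w) (S1 \<union> S2 \<union> S3 \<union> S4) \<longleftrightarrow>
        \<sigma> \<in> weighted_tuples ?X k w r (\<lambda>j x. msubst to_ac x (b j))"
      unfolding zero_set_def[of "wvars k w"] weighted_tuples_def mem_Collect_eq ball_Un
      using 1 2 3 4 by blast
  qed
  finally show ?thesis .
qed

section \<open>Codewords and weighted tuples of points\<close>

definition supp :: "'a::zero vec \<Rightarrow> nat set" where
  "supp c = {m. m < dim_vec c \<and> c $ m \<noteq> 0}"

lemma finite_supp: "finite (supp c)"
  by (simp add: supp_def)

lemma hamming_weight_supp: "hamming_weight c = card (supp c)"
  by (simp add: hamming_weight_def supp_def)

text \<open>Injections are enough: for \<open>c\<close> of weight \<open>w\<close> the support has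
  \<open>w\<close> elements, so each of them is a bijection.\<close>

definition orderings :: "nat \<Rightarrow> 'a::zero vec \<Rightarrow> (nat \<Rightarrow> nat) set" where
  "orderings w c = {e \<in> {..<w} \<rightarrow>\<^sub>E supp c. inj_on e {..<w}}"

lemma bij_betw_orderings:
  assumes "hamming_weight c = w" "e \<in> orderings w c"
  shows "bij_betw e {..<w} (supp c)"
proof -
  have "e ` {..<w} = supp c"
  proof (rule card_subset_eq[OF finite_supp])
    show "card (e ` {..<w}) = card (supp c)"
      using assms by (simp add: orderings_def card_image hamming_weight_supp)
  qed (use assms in \<open>auto simp: orderings_def\<close>)
  with assms show ?thesis
    by (simp add: bij_betw_def orderings_def)
qed

lemma card_orderings:
  assumes "hamming_weight c = w"
  shows "card (orderings w c) = fact w"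
proof -
  have "card (orderings w c) = (\<Prod>i\<in>{0..<w}. w - i)"
    using card_inj_on_subset_funcset[of "{..<w}" "supp c" "{..<w}"] assms
    by (simp add: orderings_def finite_supp hamming_weight_supp)
  also have "\<dots> = fact w"
    by (simp add: fact_prod_rev)
  finally show ?thesis .
qed

lemma finite_carrier_vec: "finite (carrier_vec n :: 'a::finite vec set)"
proof -
  have "carrier_vec n \<subseteq> vec n ` ({..<n} \<rightarrow>\<^sub>E (UNIV :: 'a set))"
  proof
    fix c :: "'a vec" assume "c \<in> carrier_vec n"
    then show "c \<in> vec n ` ({..<n} \<rightarrow>\<^sub>E UNIV)"
      by (intro image_eqI[where x = "restrict (vec_index c) {..<n}"] eq_vecI) simp_all
  qed
  then show ?thesis
    by (rule finite_subset) (simp add: finite_PiE)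
qed

definition tuple_of ::
  "(nat \<Rightarrow> nat \<Rightarrow> 'a::field alg_closure) \<Rightarrow> nat \<Rightarrow> nat \<Rightarrow> 'a vec \<Rightarrow> (nat \<Rightarrow> nat)
    \<Rightarrow> wvar \<Rightarrow> 'a alg_closure" where
  "tuple_of P k w c e =
     (\<lambda>v\<in>wvars k w. case v of Coord i l \<Rightarrow> P (e i) l | Val i \<Rightarrow> to_ac (c $ e i))"

lemma tuple_of_Val: "i < w \<Longrightarrow> tuple_of P k w c e (Val i) = to_ac (c $ e i)"
  by (simp add: tuple_of_def wvars_def)

lemma solution_point_tuple_of:
  assumes "P (e i) \<in> {..<k} \<rightarrow>\<^sub>E UNIV" "i < w"
  shows "solution_point k (tuple_of P k w c e) i = P (e i)"
  using assms by (auto simp: solution_point_def tuple_of_def wvars_def PiE_def extensional_def)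

text \<open>Each entry is prescribed, either through the injective \<open>to_ac\<close> at a point
  of the tuple or as 0 elsewhere.\<close>

lemma corresponds_unique:
  assumes "corresponds P n k w \<sigma> c" "corresponds P n k w \<sigma> c'"
  shows "c = c'"
proof (rule eq_vecI)
  show "dim_vec c = dim_vec c'"
    using assms unfolding corresponds_def by (metis carrier_vecD)
  fix m assume "m < dim_vec c'"
  then have m: "m < n" using assms(2) unfolding corresponds_def by (metis carrier_vecD)
  show "c $ m = c' $ m"
  proof (cases "P m \<in> solution_point k \<sigma> ` {..<w}")
    case True
    then obtain i where "i < w" "P m = solution_point k \<sigma> i" by auto
    with m assms have "to_ac (c $ m) = to_ac (c' $ m)" by (simp add: corresponds_def)
    then show ?thesis by simp
  qed (use m assms in \<open>simp add: corresponds_def\<close>)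
qed

text \<open>Transfers the orthogonality relations between a tuple and the full codeword: terms off
  the support vanish, and \<open>e\<close> reindexes the rest.\<close>

lemma sum_supp:
  fixes c :: "'a::field vec"
  assumes "c \<in> carrier_vec n" "bij_betw e A (supp c)"
  shows "(\<Sum>i\<in>A. to_ac (c $ e i) * G (e i)) = (\<Sum>m<n. to_ac (c $ m) * G m)"
proof -
  have "(\<Sum>i\<in>A. to_ac (c $ e i) * G (e i)) = (\<Sum>m\<in>supp c. to_ac (c $ m) * G m)"
    by (rule sum.reindex_bij_betw[OF assms(2)])
  also have "\<dots> = (\<Sum>m<n. to_ac (c $ m) * G m)"
    by (rule sum.mono_neutral_left) (use assms(1) in \<open>auto simp: supp_def\<close>)
  finally show ?thesis .
qed

section \<open>Bijection between weighted tuples and codewords with ordered support\<close>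

context
  fixes P :: "nat \<Rightarrow> nat \<Rightarrow> 'a::{field, finite} alg_closure" and V :: "(nat \<Rightarrow> 'a alg_closure) set"
    and k w n r :: nat and F :: "nat \<Rightarrow> (nat \<Rightarrow> 'a alg_closure) \<Rightarrow> 'a alg_closure" and D :: "'a vec set"
  assumes P: "bij_betw P {..<n} V" and V: "V \<subseteq> {..<k} \<rightarrow>\<^sub>E UNIV"
    and D: "\<And>c. c \<in> D \<longleftrightarrow> c \<in> carrier_vec n \<and> (\<forall>j<r. (\<Sum>m<n. to_ac (c $ m) * F j (P m)) = 0)"
begin

text \<open>Injectivity of \<open>e\<close> and \<open>P\<close> makes the points distinct and lets
  a point determine its index, so the values are read off without ambiguity. Indices missed by
  \<open>e\<close> lie off the support.\<close>

lemma tuple_of_codeword: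
  assumes c: "c \<in> D" "hamming_weight c = w" and e: "e \<in> orderings w c"
  shows "tuple_of P k w c e \<in> weighted_tuples V k w r F"
    and "corresponds P n k w (tuple_of P k w c e) c"
    and "i < w \<Longrightarrow> solution_point k (tuple_of P k w c e) i = P (e i)"
proof -
  let ?\<sigma> = "tuple_of P k w c e"
  have carr: "c \<in> carrier_vec n" using c D by simp
  note bij = bij_betw_orderings[OF c(2) e]
  have e_lt: "e i < n" "c $ e i \<noteq> 0" if "i < w" for i
    using bij_betwE[OF bij] that carr by (auto simp: supp_def)
  have PV: "P m \<in> V" if "m < n" for m
    using bij_betwE[OF P] that by simp
  have pt: "solution_point k ?\<sigma> i = P (e i)" if "i < w" for i
    by (rule solution_point_tuple_of[where P = P and e = e, OF subsetD[OF V PV[OF e_lt(1)[OF that]]] that])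
  then show "i < w \<Longrightarrow> solution_point k ?\<sigma> i = P (e i)" .
  have "inj_on (\<lambda>i. P (e i)) {..<w}"
    using bij_betw_imp_inj_on[OF bij] bij_betw_imp_inj_on[OF P] e_lt
    by (auto simp: inj_on_def)
  then have inj: "inj_on (solution_point k ?\<sigma>) {..<w}"
    by (subst inj_on_cong[of _ _ "\<lambda>i. P (e i)"]) (simp_all add: pt)
  have "(\<Sum>i<w. ?\<sigma> (Val i) * F j (solution_point k ?\<sigma> i)) = 0" if "j < r" for j
  proof -
    have "(\<Sum>i<w. ?\<sigma> (Val i) * F j (solution_point k ?\<sigma> i)) = (\<Sum>i<w. to_ac (c $ e i) * F j (P (e i)))"
      by (simp add: pt tuple_of_Val)
    also have "\<dots> = (\<Sum>m<n. to_ac (c $ m) * F j (P m))"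
      by (rule sum_supp[OF carr bij])
    finally show ?thesis using c D that by simp
  qed
  moreover have "?\<sigma> \<in> wvars k w \<rightarrow>\<^sub>E UNIV"
    by (simp add: tuple_of_def)
  ultimately show "?\<sigma> \<in> weighted_tuples V k w r F"
    using inj pt PV e_lt by (simp add: weighted_tuples_def tuple_of_Val)
  show "corresponds P n k w ?\<sigma> c"
    unfolding corresponds_def
  proof (intro conjI allI impI carr)
    fix m i assume "m < n" "i < w" "P m = solution_point k ?\<sigma> i"
    then have "m = e i"
      using pt e_lt bij_betw_imp_inj_on[OF P] by (auto simp: inj_on_def)
    then show "to_ac (c $ m) = ?\<sigma> (Val i)"
      using \<open>i < w\<close> by (simp add: tuple_of_Val)
  next
    fix m assume "m < n" "P m \<notin> solution_point k ?\<sigma> ` {..<w}"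
    then have "m \<notin> e ` {..<w}" using pt by auto
    then show "c $ m = 0"
      using bij_betw_imp_surj_on[OF bij] \<open>m < n\<close> carr by (simp add: supp_def)
  qed
qed

lemma weighted_tuple_codeword:
  assumes "\<sigma> \<in> weighted_tuples V k w r F"
  obtains c e where "c \<in> D" "hamming_weight c = w" "e \<in> orderings w c" "\<sigma> = tuple_of P k w c e"
proof -
  let ?p = "solution_point k \<sigma>"
  have ext: "\<sigma> \<in> wvars k w \<rightarrow>\<^sub>E UNIV" and pV: "\<And>i. i < w \<Longrightarrow> ?p i \<in> V"
    and inj: "inj_on ?p {..<w}"
    and val: "\<And>i. i < w \<Longrightarrow> \<sigma> (Val i) \<in> range to_ac" "\<And>i. i < w \<Longrightarrow> \<sigma> (Val i) \<noteq> 0"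
    and orth: "\<And>j. j < r \<Longrightarrow> (\<Sum>i<w. \<sigma> (Val i) * F j (?p i)) = 0"
    using assms by (simp_all add: weighted_tuples_def)
  \<comment> \<open>\<open>e i\<close> is the position of the \<open>i\<close>-th point of the tuple
    in the enumeration \<open>P\<close>; restriction keeps \<open>e\<close> extensional.\<close>
  define e where "e = (\<lambda>i\<in>{..<w}. the_inv_into {..<n} P (?p i))"
  have e: "e i < n" "P (e i) = ?p i" if "i < w" for i
    using the_inv_into_into[OF bij_betw_imp_inj_on[OF P], of "?p i" "{..<n}"]
      f_the_inv_into_f_bij_betw[OF P, of "?p i"] pV[OF that] bij_betw_imp_surj_on[OF P] that
    by (simp_all add: e_def)
  have inj_e: "inj_on e {..<w}"
    using inj e by (metis inj_on_def lessThan_iff)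
  \<comment> \<open>As \<open>e\<close> is injective, its inverse recovers which tuple entry belongs
    at position \<open>m\<close>; positions that \<open>e\<close> misses get 0.\<close>
  define c where "c = vec n (\<lambda>m. if m \<in> e ` {..<w} then of_ac (\<sigma> (Val (the_inv_into {..<w} e m))) else 0)"
  have carr: "c \<in> carrier_vec n" by (simp add: c_def)
  have c_e: "to_ac (c $ e i) = \<sigma> (Val i)" if "i < w" for i
    using e that inj_e val(1)[OF that] by (simp add: c_def the_inv_into_f_f to_ac_of_ac)
  have c_e0: "c $ e i \<noteq> 0" if "i < w" for i
    using c_e[OF that] val(2)[OF that] by auto
  have supp: "supp c = e ` {..<w}"
    using carr e c_e0 by (auto simp: supp_def) (simp add: c_def split: if_splits)
  have ord: "e \<in> orderings w c"
    using inj_e by (simp add: orderings_def supp PiE_def e_def)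
  have hw: "hamming_weight c = w"
    by (simp add: hamming_weight_supp supp card_image inj_e)
  have "c \<in> D"
    unfolding D
  proof (intro conjI carr allI impI)
    fix j assume "j < r"
    have "(\<Sum>m<n. to_ac (c $ m) * F j (P m)) = (\<Sum>i<w. to_ac (c $ e i) * F j (P (e i)))"
      by (rule sum_supp[OF carr bij_betw_orderings[OF hw ord], symmetric])
    also have "\<dots> = 0"
      using orth[OF \<open>j < r\<close>] by (simp add: c_e e)
    finally show "(\<Sum>m<n. to_ac (c $ m) * F j (P m)) = 0" .
  qed
  moreover have "\<sigma> = tuple_of P k w c e"
  proof
    fix v
    show "\<sigma> v = tuple_of P k w c e v"
    proof (cases "v \<in> wvars k w")
      case True
      then show ?thesis
        by (auto simp: wvars_def tuple_of_def c_e e solution_point_def)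
    next
      case False
      then show ?thesis
        using ext by (auto simp: tuple_of_def PiE_def extensional_def)
    qed
  qed
  ultimately show ?thesis using that hw ord by blast
qed

text \<open>For injectivity, the tuple determines \<open>c\<close> by uniqueness of the
  corresponding vector, and its points determine \<open>e\<close> because \<open>P\<close> is
  injective.\<close>

lemma bij_betw_tuple_of:
  "bij_betw (\<lambda>(c, e). tuple_of P k w c e)
     (SIGMA c:{c \<in> D. hamming_weight c = w}. orderings w c) (weighted_tuples V k w r F)"
proof (rule bij_betw_imageI)
  let ?S = "SIGMA c:{c \<in> D. hamming_weight c = w}. orderings w c"
  show "inj_on (\<lambda>(c, e). tuple_of P k w c e) ?S"
  proof (rule inj_onI)
    fix x x'
    assume "x \<in> ?S" "x' \<in> ?S" and eq': "(case x of (c, e) \<Rightarrow> tuple_of P k w c e) =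
      (case x' of (c, e) \<Rightarrow> tuple_of P k w c e)"
    then obtain c e c' e' where x: "x = (c, e)" "x' = (c', e')"
      and c: "c \<in> D" "hamming_weight c = w" and e: "e \<in> orderings w c"
      and c': "c' \<in> D" "hamming_weight c' = w" and e': "e' \<in> orderings w c'"
      by auto
    have eq: "tuple_of P k w c e = tuple_of P k w c' e'" using eq' x by simp
    note C = tuple_of_codeword[OF c e] and C' = tuple_of_codeword[OF c' e']
    have "c = c'"
      using corresponds_unique[OF C(2)] C'(2) eq by simp
    moreover have "e i = e' i" for i
    proof (cases "i < w")
      case True
      have "P (e i) = P (e' i)" using C(3)[OF True] C'(3)[OF True] eq by simp
      moreover have "e i < n" "e' i < n"
        using e e' True c c' D by (auto simp: orderings_def supp_def PiE_def Pi_def)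
      ultimately show ?thesis
        using bij_betw_imp_inj_on[OF P] by (auto simp: inj_on_def)
    next
      case False
      with e e' show ?thesis by (auto simp: orderings_def PiE_def extensional_def)
    qed
    ultimately show "x = x'" using x by auto
  qed
  show "(\<lambda>(c, e). tuple_of P k w c e) ` ?S = weighted_tuples V k w r F"
    using tuple_of_codeword(1) by (force elim: weighted_tuple_codeword)
qed

lemma weighted_tuple_corresponds:
  assumes "\<sigma> \<in> weighted_tuples V k w r F"
  shows "\<exists>!c. corresponds P n k w \<sigma> c"
    and "corresponds P n k w \<sigma> c \<Longrightarrow> c \<in> D \<and> hamming_weight c = w"
proof -
  obtain c' e where c': "c' \<in> D" "hamming_weight c' = w" "e \<in> orderings w c'" "\<sigma> = tuple_of P k w c' e"
    using weighted_tuple_codeword[OF assms] by metis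
  then have corr: "corresponds P n k w \<sigma> c'"
    using tuple_of_codeword(2) by simp
  then show "\<exists>!c. corresponds P n k w \<sigma> c"
    using corresponds_unique by blast
  show "c \<in> D \<and> hamming_weight c = w" if "corresponds P n k w \<sigma> c"
    using corresponds_unique[OF that corr] c' by simp
qed

text \<open>In the dependent sum every codeword of weight \<open>w\<close> has a fibre of the same
  size \<open>fact w\<close>.\<close>

lemma finite_weighted_tuples: "finite (weighted_tuples V k w r F)"
  and card_weighted_tuples: "card (weighted_tuples V k w r F) = weight_count D w * fact w"
proof -
  let ?D = "{c \<in> D. hamming_weight c = w}"
  have fin: "finite ?D"
    by (rule finite_subset[OF _ finite_carrier_vec[of n]]) (use D in auto)
  have fin_ord: "\<forall>c\<in>?D. finite (orderings w c)"
    by (auto simp: orderings_def intro!: finite_PiE finite_supp)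
  show "finite (weighted_tuples V k w r F)"
    using bij_betw_finite[OF bij_betw_tuple_of] fin fin_ord by auto
  have "card (weighted_tuples V k w r F) = card (SIGMA c:?D. orderings w c)"
    by (rule bij_betw_same_card[OF bij_betw_tuple_of, symmetric])
  also have "\<dots> = (\<Sum>c\<in>?D. fact w)"
    using fin fin_ord by (subst card_SigmaI) (auto simp: card_orderings)
  also have "\<dots> = weight_count D w * fact w"
    by (simp add: weight_count_def)
  finally show "card (weighted_tuples V k w r F) = weight_count D w * fact w" .
qed

end

theorem proposition2p2:
  fixes k s r n w :: nat
    and g b :: "nat \<Rightarrow> (nat, 'a::{field, finite}) mpol"
    and I :: "(nat, 'a) mpol set"
    and P :: "nat \<Rightarrow> nat \<Rightarrow> 'a alg_closure"
    and L :: "(nat, 'a) mpol set set"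
    and J :: "(wvar, 'a) mpol set"
  assumes g: "\<And>h. h < s \<Longrightarrow> g h \<in> carrier (mpoly_ring {..<k})"
    and I: "I = Idl\<^bsub>mpoly_ring {..<k}\<^esub> (g ` {..<s})"
    and field_eqs: "\<And>l. l < k \<Longrightarrow> mvar l ^ CARD('a) - mvar l \<in> I"
    and P: "bij_betw P {..<n} (zero_set {..<k} I)"
    and b: "\<And>j. j < r \<Longrightarrow> b j \<in> carrier (mpoly_ring {..<k})"
    and L: "L = ring.Span (mpoly_ring {..<k} Quot I) (quot_scalars {..<k} I)
                  (map (\<lambda>j. I +>\<^bsub>mpoly_ring {..<k}\<^esub> b j) [0..<r])"
    and dim_L: "ring.dimension (mpoly_ring {..<k} Quot I) r (quot_scalars {..<k} I) L"
    and w: "1 \<le> w" "w \<le> n"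
    and J: "J = weight_ideal k w s g r b"
  shows "(\<forall>\<sigma>\<in>zero_set (wvars k w) J.
            (\<forall>i<w. solution_point k \<sigma> i \<in> zero_set {..<k} I) \<and>
            (\<exists>!c. corresponds P n k w \<sigma> c) \<and>
            (\<forall>c. corresponds P n k w \<sigma> c \<longrightarrow>
               c \<in> dual_affine_variety_code P n L \<and> hamming_weight c = w)) \<and>
         finite (zero_set (wvars k w) J) \<and>
         real (weight_count (dual_affine_variety_code P n L) w)
           = real (card (zero_set (wvars k w) J)) / fact w"
proof -
  let ?X = "zero_set {..<k} I" and ?F = "\<lambda>j x. msubst to_ac x (b j)"
  have g': "mvars (g h) \<subseteq> {..<k}" if "h < s" for h using g[OF that] by simp
  have b': "mvars (b j) \<subseteq> {..<k}" if "j < r" for j using b[OF that] by simp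
  have ideal: "ideal I (mpoly_ring {..<k})"
    unfolding I by (rule ring.genideal_ideal[OF ring_mpoly_ring]) (use g' in auto)
  \<comment> \<open>The weight ideal mentions the \<open>g h\<close>, while \<open>P\<close>
    enumerates the zeros of \<open>I\<close>; this equation joins the two.\<close>
  have X: "?X = zero_set {..<k} (g ` {..<s})"
    unfolding I by (rule zero_set_genideal) (use g' in auto)
  \<comment> \<open>At a zero of \<open>I\<close> the field equation says x_l^q = x_l, which
    characterizes the ground field.\<close>
  have rational: "x l \<in> range to_ac" if "x \<in> ?X" "l < k" for x l
    using zero_set_mem_ideal[OF that(1) field_eqs[OF that(2)]]
    by (simp add: msubst_ac_hom.hom_minus msubst_ac_hom.hom_power to_ac_hom.msubst_mvar
        range_to_ac_iff)
  have Z: "zero_set (wvars k w) J = weighted_tuples ?X k w r ?F"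
    unfolding J X by (rule zero_set_weight_ideal) (use g' b' rational X in auto)
  have PX: "P m \<in> ?X" if "m < n" for m
    using bij_betwE[OF P] that by simp
  have D: "c \<in> dual_affine_variety_code P n L \<longleftrightarrow>
      c \<in> carrier_vec n \<and> (\<forall>j<r. (\<Sum>m<n. to_ac (c $ m) * ?F j (P m)) = 0)" for c
    by (rule dual_affine_variety_code_iff[OF ideal b' PX _ L]) (use PX rational in auto)
  have ext: "?X \<subseteq> {..<k} \<rightarrow>\<^sub>E UNIV"
    by (auto simp: zero_set_def)
  show ?thesis
    unfolding Z
  proof (intro conjI ballI allI impI)
    fix \<sigma> assume \<sigma>: "\<sigma> \<in> weighted_tuples ?X k w r ?F"
    show "solution_point k \<sigma> i \<in> ?X" if "i < w" for i
      using \<sigma> that by (simp add: weighted_tuples_def)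
    show "\<exists>!c. corresponds P n k w \<sigma> c"
      by (rule weighted_tuple_corresponds(1)[OF P ext D \<sigma>])
    fix c assume "corresponds P n k w \<sigma> c"
    then show "c \<in> dual_affine_variety_code P n L" "hamming_weight c = w"
      using weighted_tuple_corresponds(2)[OF P ext D \<sigma>] by auto
  next
    show "finite (weighted_tuples ?X k w r ?F)"
      by (rule finite_weighted_tuples[OF P ext D])
    show "real (weight_count (dual_affine_variety_code P n L) w) =
        real (card (weighted_tuples ?X k w r ?F)) / fact w"
      by (subst card_weighted_tuples[OF P ext D]) simp
  qed
qed

end
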